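(* Let $n \in \mathbb{N}$ and let $S = \{g_1, \dots, g_s\} \subseteq \mathbb{Q}[X] = \mathbb{Q}[X_1, \dots, X_n]$ be a finite set of polynomials. Suppose $N \in \mathbb{N}$ is such that $N - \sum_{i=1}^n X_i^2 \in M_S$, where $M_S \subseteq \mathbb{R}[X]$ is the quadratic module generated by $S$ in $\mathbb{R}[X]$. Then for any $f \in \mathbb{Q}[X]$ such that $f > 0$ on $K_S$ (that is, $f(x) > 0$ for all $x \in K_S$), there exist $\sigma_0, \dots, \sigma_s, \sigma \in \sum \mathbb{Q}[X]^2$ such that $$f = \sigma_0 + \sigma_1 g_1 + \dots + \sigma_s g_s + \sigma \left(N - \sum_{i=1}^n X_i^2\right).$$
   Context: $\mathbb{R}[X] = \mathbb{R}[X_1, \dots, X_n]$. For $R = \mathbb{R}$ or $R = \mathbb{Q}$, $\sum R[X]^2$ denotes the set of finite sums of squares of polynomials in $R[X]$. For $S = \{g_1, \dots, g_s\} \subseteq \mathbb{R}[X]$, the basic closed semialgebraic set generated by $S$ is $K_S = \{x \in \mathbb{R}^n \mid g_1(x) \geq 0, \dots, g_s(x) \geq 0\}$, and the quadratic module generated by $S$ is $$M_S = \left\{ \sigma_0 + \sigma_1 g_1 + \dots + \sigma_s g_s \;\middle|\; \sigma_i \in \sum \mathbb{R}[X]^2 \text{ for } i = 0, \dots, s \right\}.$$ *)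

theory Defs
  imports Complex_Main "HOL-Library.Poly_Mapping" "HOL-Library.FuncSet"
begin

text \<open>
  A polynomial is a finitely supported map from monomials to real coefficients; a monomial is a
  finitely supported map from variable indices to exponents.  The library's convolution product
  makes this type the commutative ring of real polynomials in the variables $X_0, X_1, \dots$.
\<close>

type_synonym rpoly = "(nat \<Rightarrow>\<^sub>0 nat) \<Rightarrow>\<^sub>0 real"

definition X :: "nat \<Rightarrow> rpoly" where
  "X i = Poly_Mapping.single (Poly_Mapping.single i 1) 1"

text \<open>
  \<open>polys R n\<close> is $R[X_1, \dots, X_n]$ for a subring $R$ of the reals; it is used with
  \<open>R = UNIV\<close> and \<open>R = \<rat>\<close>, so that $\mathbb{Q}[X]$ is literally a subset of $\mathbb{R}[X]$.
\<close>

definition polys :: "real set \<Rightarrow> nat \<Rightarrow> rpoly set" where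
  "polys R n = {p. \<forall>m \<in> Poly_Mapping.keys p.
     Poly_Mapping.lookup p m \<in> R \<and> Poly_Mapping.keys m \<subseteq> {1..n}}"

definition peval :: "(nat \<Rightarrow> real) \<Rightarrow> rpoly \<Rightarrow> real" where
  "peval x p = (\<Sum>m \<in> Poly_Mapping.keys p.
     Poly_Mapping.lookup p m * (\<Prod>i \<in> Poly_Mapping.keys m. x i ^ Poly_Mapping.lookup m i))"

definition sos :: "real set \<Rightarrow> nat \<Rightarrow> rpoly set" where
  "sos R n = {\<Sum>k<l. (q k)\<^sup>2 | (l :: nat) q. \<forall>k<l. q k \<in> polys R n}"

text \<open>
  The generators are given as a family $g_1, \dots, g_s$ (only the values \<open>g 1, \<dots>, g s\<close> matter).
  Points of $\mathbb{R}^n$ are functions on \<open>{1..n}\<close>, undefined elsewhere.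
\<close>

definition semialg_set :: "nat \<Rightarrow> nat \<Rightarrow> (nat \<Rightarrow> rpoly) \<Rightarrow> (nat \<Rightarrow> real) set" where
  "semialg_set n s g = {x \<in> {1..n} \<rightarrow>\<^sub>E UNIV. \<forall>i \<in> {1..s}. peval x (g i) \<ge> 0}"

definition quadratic_module :: "nat \<Rightarrow> nat \<Rightarrow> (nat \<Rightarrow> rpoly) \<Rightarrow> rpoly set" where
  "quadratic_module n s g =
     {\<sigma> 0 + (\<Sum>i = 1..s. \<sigma> i * g i) | \<sigma>. \<forall>i \<in> {0..s}. \<sigma> i \<in> sos UNIV n}"

end

theory Submission
  imports Defs "HOL-Analysis.Function_Topology"
begin

text \<open>
  Write $G = N - \sum_i X_i^2$ and let $B = [-M, M]^n$ with $M = N + 1$, a box that contains the ball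
  $G \ge 0$.  All polynomials that are built below have rational coefficients: the analysis only
  decides how large certain natural numbers have to be.

  The first idea is to reduce to a polynomial that is positive on the whole box.  The given $f$ is
  positive at the points of $B$ where $G \ge 0$ and all $g_i \ge 0$.  Put $g_0 = G$ and subtract from
  $f$ the penalties
  $$h = f - C \sum_{i=0}^s \Bigl(1 - \frac{g_i}{R}\Bigr)^{2k} g_i .$$
  For a suitable choice of natural numbers $C$, $R$, $k$ this makes $h$ positive on all of $B$
  (\<open>positive_after_penalty\<close>): where some $g_i$ is negative its penalty raises the value of $f$ as much
  as desired, and where $g_i$ is nonnegative the penalty is uniformly small for large $k$.
  The subtracted terms are rational squares times generators, so it remains to represent $h$.

  The second idea is that of Bernstein: the coefficients of $h$ in the Bernstein basis of
  $B$ in degree $d$ are rational and approach the values of $h$ on a grid as $d$ grows, so they are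
  eventually positive (\<open>positive_on_box\<close>).  Hence $h$ is obtained from nonnegative rationals and the
  polynomials $M \pm X_i$ by sums and products.

  Finally, the set of all $a + b G$ with $a$, $b$ sums of rational squares is closed under sums and
  products (\<open>preordering_mult\<close>) and contains $M \pm X_i$ (\<open>box_face_in_ball_preordering\<close>), because the
  ball lies in the box for a simple algebraic reason.  So it contains $h$.
\<close>

section \<open>Expansion into monomials\<close>

definition const :: "real \<Rightarrow> rpoly" where
  "const c = Poly_Mapping.single 0 c"

lemma const_simps [simp]:
  "const 0 = 0" "const 1 = 1" "const (of_nat k) = of_nat k"
  by (simp_all add: const_def)

lemma const_add: "const (a + b) = const a + const b"
  by (simp add: const_def single_add)

lemma const_diff: "const (a - b) = const a - const b"
  by (simp add: const_def single_diff)

lemma const_mult: "const (a * b) = const a * const b"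
  by (simp add: const_def mult_single)

lemma const_power: "const (a ^ k) = const a ^ k"
  by (induction k) (simp_all add: const_mult)

lemma const_prod: "const (prod a I) = (\<Prod>i\<in>I. const (a i))"
  by (induction I rule: infinite_finite_induct) (simp_all add: const_mult)

lemma X_power: "X i ^ k = Poly_Mapping.single (Poly_Mapping.single i k) 1"
proof (induction k)
  case (Suc k)
  then show ?case
    by (simp add: X_def mult_single flip: single_add)
qed simp

lemma prod_single_1:
  "(\<Prod>i\<in>I. Poly_Mapping.single (e i) (1::real)) = Poly_Mapping.single (\<Sum>i\<in>I. e i) 1"
  by (induction I rule: infinite_finite_induct) (simp_all add: mult_single)

lemma sum_singles:
  assumes "finite A" "Poly_Mapping.keys p \<subseteq> A"
  shows "(\<Sum>m\<in>A. Poly_Mapping.single m (Poly_Mapping.lookup p m)) = p"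
proof (rule poly_mapping_eqI)
  fix k
  have "(\<Sum>m\<in>A. Poly_Mapping.lookup (Poly_Mapping.single m (Poly_Mapping.lookup p m)) k) =
      (\<Sum>m\<in>A. if m = k then Poly_Mapping.lookup p k else 0)"
    by (intro sum.cong) (auto simp: lookup_single)
  also have "\<dots> = Poly_Mapping.lookup p k"
    using assms by (auto simp: in_keys_iff)
  finally show "Poly_Mapping.lookup (\<Sum>m\<in>A. Poly_Mapping.single m (Poly_Mapping.lookup p m)) k =
      Poly_Mapping.lookup p k"
    by (simp add: lookup_sum)
qed

text \<open>
  The index set is any finite superset of the support, so that all monomials of a polynomial in
  $X_1, \dots, X_n$ can be written as products over the same set $\{1, \dots, n\}$.
\<close>

lemma single_eq_const_times_monomial:
  assumes "finite I" "Poly_Mapping.keys m \<subseteq> I"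
  shows "Poly_Mapping.single m c = const c * (\<Prod>i\<in>I. X i ^ Poly_Mapping.lookup m i)"
  using assms by (simp add: X_power prod_single_1 sum_singles const_def mult_single)

text \<open>
  This lets a property of polynomials that is stable under sums and scaling be checked on monomials.
\<close>

lemma sum_const_times_monomials:
  assumes "p \<in> polys R n"
  shows "p = (\<Sum>m\<in>Poly_Mapping.keys p.
    const (Poly_Mapping.lookup p m) * (\<Prod>i\<in>{1..n}. X i ^ Poly_Mapping.lookup m i))"
proof -
  have "p = (\<Sum>m\<in>Poly_Mapping.keys p. Poly_Mapping.single m (Poly_Mapping.lookup p m))"
    by (simp add: sum_singles)
  also have "\<dots> = (\<Sum>m\<in>Poly_Mapping.keys p.
      const (Poly_Mapping.lookup p m) * (\<Prod>i\<in>{1..n}. X i ^ Poly_Mapping.lookup m i))"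
    using assms by (intro sum.cong refl single_eq_const_times_monomial) (auto simp: polys_def)
  finally show ?thesis .
qed

section \<open>Evaluation is a ring homomorphism\<close>

definition meval :: "(nat \<Rightarrow> real) \<Rightarrow> (nat \<Rightarrow>\<^sub>0 nat) \<Rightarrow> real" where
  "meval x m = (\<Prod>i \<in> Poly_Mapping.keys m. x i ^ Poly_Mapping.lookup m i)"

lemma meval_superset:
  assumes "finite I" "Poly_Mapping.keys m \<subseteq> I"
  shows "meval x m = (\<Prod>i\<in>I. x i ^ Poly_Mapping.lookup m i)"
  unfolding meval_def using assms by (intro prod.mono_neutral_left) (auto simp: in_keys_iff)

lemma meval_add: "meval x (m + m') = meval x m * meval x m'"
proof -
  let ?I = "Poly_Mapping.keys m \<union> Poly_Mapping.keys m'"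
  have "meval x (m + m') = (\<Prod>i\<in>?I. x i ^ Poly_Mapping.lookup (m + m') i)"
    by (intro meval_superset) (auto dest: set_mp[OF keys_add])
  also have "\<dots> = meval x m * meval x m'"
    by (simp add: lookup_add power_add prod.distrib meval_superset[of ?I])
  finally show ?thesis .
qed

lemma peval_superset:
  assumes "finite A" "Poly_Mapping.keys p \<subseteq> A"
  shows "peval x p = (\<Sum>m\<in>A. Poly_Mapping.lookup p m * meval x m)"
  unfolding peval_def meval_def[symmetric] using assms
  by (intro sum.mono_neutral_left) (auto simp: in_keys_iff)

lemma peval_add [simp]: "peval x (p + q) = peval x p + peval x q"
proof -
  let ?A = "Poly_Mapping.keys p \<union> Poly_Mapping.keys q"
  have "peval x (p + q) = (\<Sum>m\<in>?A. Poly_Mapping.lookup (p + q) m * meval x m)"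
    by (intro peval_superset) (auto dest: set_mp[OF keys_add])
  also have "\<dots> = peval x p + peval x q"
    by (simp add: lookup_add distrib_right sum.distrib peval_superset[of ?A])
  finally show ?thesis .
qed

lemma peval_single: "peval x (Poly_Mapping.single m c) = c * meval x m"
  using peval_superset[of "{m}" "Poly_Mapping.single m c" x] by (simp split: if_splits)

lemma peval_zero [simp]: "peval x 0 = 0"
  by (simp add: peval_def)

lemma peval_sum [simp]: "peval x (sum p A) = (\<Sum>a\<in>A. peval x (p a))"
  by (induction A rule: infinite_finite_induct) simp_all

lemma peval_const [simp]: "peval x (const c) = c"
  by (simp add: const_def peval_single meval_def)

lemma peval_one [simp]: "peval x 1 = 1"
  using peval_const[of x 1] by simp

lemma peval_of_nat [simp]: "peval x (of_nat k) = of_nat k"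
  using peval_const[of x "of_nat k"] by simp

lemma peval_X [simp]: "peval x (X i) = x i"
  by (simp add: X_def peval_single meval_def)

lemma peval_mult [simp]: "peval x (p * q) = peval x p * peval x q"
proof -
  let ?s = "\<lambda>p m. Poly_Mapping.single m (Poly_Mapping.lookup p m)"
  have "p * q = (\<Sum>m\<in>Poly_Mapping.keys p. ?s p m) * (\<Sum>m\<in>Poly_Mapping.keys q. ?s q m)"
    by (simp add: sum_singles)
  also have "peval x \<dots> = (\<Sum>m\<in>Poly_Mapping.keys p. \<Sum>m'\<in>Poly_Mapping.keys q.
      (Poly_Mapping.lookup p m * meval x m) * (Poly_Mapping.lookup q m' * meval x m'))"
    by (simp add: sum_product mult_single peval_single meval_add mult_ac)
  also have "\<dots> = peval x p * peval x q"
    by (simp add: peval_superset[of "Poly_Mapping.keys p" p] peval_superset[of "Poly_Mapping.keys q" q]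
        sum_product)
  finally show ?thesis .
qed

lemma peval_diff [simp]: "peval x (p - q) = peval x p - peval x q"
  using peval_add[of x "p - q" q] by simp

lemma peval_power [simp]: "peval x (p ^ k) = peval x p ^ k"
  by (induction k) simp_all

lemma peval_prod [simp]: "peval x (prod p A) = (\<Prod>a\<in>A. peval x (p a))"
  by (induction A rule: infinite_finite_induct) simp_all

lemma continuous_on_peval: "continuous_on S (\<lambda>x. peval x p)"
  unfolding peval_def
  by (intro continuous_intros continuous_on_subset[OF continuous_on_product_coordinates]) auto

text \<open>
  The points of the box are undefined outside \<open>I\<close>, so the box is a product over all indices in
  which the remaining factors are the singleton of the undefined value; Tychonoff's theorem applies.
\<close>

lemma compact_box: "compact (PiE I (\<lambda>_. {-M..M::real}))"
proof -
  let ?S = "\<lambda>i. if i \<in> I then {-M..M} else {undefined}"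
  have "compactin (product_topology (\<lambda>_. euclidean) UNIV) (PiE UNIV ?S)"
    by (subst compactin_PiE) auto
  moreover have "PiE UNIV ?S = PiE I (\<lambda>_. {-M..M})"
    by (auto simp: PiE_def Pi_def extensional_def split: if_splits)
  ultimately show ?thesis
    by (simp add: euclidean_product_topology)
qed

section \<open>The ring of rational polynomials\<close>

lemma polys_rat_iff:
  "p \<in> polys \<rat> n \<longleftrightarrow>
    range (Poly_Mapping.lookup p) \<subseteq> \<rat> \<and> (\<forall>m\<in>Poly_Mapping.keys p. Poly_Mapping.keys m \<subseteq> {1..n})"
proof -
  have "Poly_Mapping.lookup p m \<in> \<rat>" if "m \<notin> Poly_Mapping.keys p" for m
    using that by (simp add: in_keys_iff)
  then show ?thesis
    unfolding polys_def by blast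
qed

lemma polys_add:
  assumes "p \<in> polys \<rat> n" "q \<in> polys \<rat> n"
  shows "p + q \<in> polys \<rat> n"
proof -
  have "range (Poly_Mapping.lookup (p + q)) \<subseteq> \<rat>"
    using assms by (auto simp: polys_rat_iff lookup_add image_subset_iff)
  moreover have "Poly_Mapping.keys m \<subseteq> {1..n}" if "m \<in> Poly_Mapping.keys (p + q)" for m
    using that assms set_mp[OF keys_add that] by (auto simp: polys_rat_iff)
  ultimately show ?thesis
    by (simp add: polys_rat_iff)
qed

lemma polys_const: "c \<in> \<rat> \<Longrightarrow> const c \<in> polys \<rat> n"
  by (auto simp: const_def polys_def)

lemma polys_0: "0 \<in> polys \<rat> n"
  by (simp add: polys_def)

lemma polys_X: "i \<in> {1..n} \<Longrightarrow> X i \<in> polys \<rat> n"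
  by (auto simp: X_def polys_def)

lemma polys_sum: "(\<And>a. a \<in> A \<Longrightarrow> p a \<in> polys \<rat> n) \<Longrightarrow> sum p A \<in> polys \<rat> n"
  using polys_0 by (induction A rule: infinite_finite_induct) (auto intro: polys_add)

lemma polys_mult:
  assumes "p \<in> polys \<rat> n" "q \<in> polys \<rat> n"
  shows "p * q \<in> polys \<rat> n"
proof -
  let ?s = "\<lambda>p m. Poly_Mapping.single m (Poly_Mapping.lookup p m)"
  have "p * q = (\<Sum>m\<in>Poly_Mapping.keys p. ?s p m) * (\<Sum>m\<in>Poly_Mapping.keys q. ?s q m)"
    by (simp add: sum_singles)
  also have "\<dots> \<in> polys \<rat> n"
    unfolding sum_product mult_single
  proof (intro polys_sum)
    fix m m' assume mm': "m \<in> Poly_Mapping.keys p" "m' \<in> Poly_Mapping.keys q"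
    then have "Poly_Mapping.keys (m + m') \<subseteq> {1..n}"
      using keys_add[of m m'] assms unfolding polys_def by blast
    then show "Poly_Mapping.single (m + m') (Poly_Mapping.lookup p m * Poly_Mapping.lookup q m')
        \<in> polys \<rat> n"
      using mm' assms by (simp add: polys_def)
  qed
  finally show ?thesis .
qed

lemma polys_diff:
  assumes "p \<in> polys \<rat> n" "q \<in> polys \<rat> n"
  shows "p - q \<in> polys \<rat> n"
proof -
  have "p - q = p + const (-1) * q"
    using const_diff[of 0 1] by simp
  also have "\<dots> \<in> polys \<rat> n"
    using assms by (intro polys_add polys_mult polys_const) auto
  finally show ?thesis .
qed

lemma polys_power: "p \<in> polys \<rat> n \<Longrightarrow> p ^ k \<in> polys \<rat> n"
  using polys_const[of 1 n] by (induction k) (simp_all add: polys_mult)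

lemma polys_of_nat: "of_nat k \<in> polys \<rat> n"
  using polys_const[of "of_nat k" n] by simp

section \<open>Sums of squares\<close>

lemma sos_0: "0 \<in> sos \<rat> n"
  unfolding sos_def by (auto intro!: exI[of _ 0])

lemma sos_add_square:
  assumes "p \<in> sos \<rat> n" "q \<in> polys \<rat> n"
  shows "p + q\<^sup>2 \<in> sos \<rat> n"
proof -
  from assms(1) obtain l and r :: "nat \<Rightarrow> rpoly" where p: "p = (\<Sum>k<l. (r k)\<^sup>2)" and "\<forall>k<l. r k \<in> polys \<rat> n"
    unfolding sos_def by auto
  then have "p + q\<^sup>2 = (\<Sum>k<Suc l. ((r(l := q)) k)\<^sup>2)" "\<forall>k<Suc l. (r(l := q)) k \<in> polys \<rat> n"
    using assms(2) by (auto simp: less_Suc_eq)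
  then show ?thesis
    unfolding sos_def by blast
qed

lemma sos_induct [consumes 1, case_names zero add_square]:
  assumes "p \<in> sos \<rat> n"
    and "P 0"
    and "\<And>p q. p \<in> sos \<rat> n \<Longrightarrow> P p \<Longrightarrow> q \<in> polys \<rat> n \<Longrightarrow> P (p + q\<^sup>2)"
  shows "P p"
proof -
  from assms(1) obtain l and r :: "nat \<Rightarrow> rpoly" where p: "p = (\<Sum>k<l. (r k)\<^sup>2)" and r: "\<forall>k<l. r k \<in> polys \<rat> n"
    unfolding sos_def by auto
  have "(\<Sum>k<j. (r k)\<^sup>2) \<in> sos \<rat> n \<and> P (\<Sum>k<j. (r k)\<^sup>2)" if "j \<le> l" for j
    using that r by (induction j) (auto simp: sos_0 assms(2) intro: sos_add_square assms(3))
  then show ?thesis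
    using p by blast
qed

lemma sos_square: "q \<in> polys \<rat> n \<Longrightarrow> q\<^sup>2 \<in> sos \<rat> n"
  using sos_add_square[OF sos_0] by simp

lemma sos_add:
  assumes "p \<in> sos \<rat> n" "q \<in> sos \<rat> n"
  shows "p + q \<in> sos \<rat> n"
  using assms(2,1)
  by (induction rule: sos_induct) (auto simp: add.assoc[symmetric] intro: sos_add_square)

lemma sos_sum: "(\<And>a. a \<in> A \<Longrightarrow> p a \<in> sos \<rat> n) \<Longrightarrow> sum p A \<in> sos \<rat> n"
  by (induction A rule: infinite_finite_induct) (auto intro: sos_add sos_0)

text \<open>
  Multiplying out, the product of two sums of squares is the sum of the $(r t)^2$ over all pairs of
  summands.
\<close>

lemma sos_mult:
  assumes "p \<in> sos \<rat> n" "q \<in> sos \<rat> n"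
  shows "p * q \<in> sos \<rat> n"
proof -
  have "r\<^sup>2 * q \<in> sos \<rat> n" if "r \<in> polys \<rat> n" for r
    using assms(2)
  proof (induction rule: sos_induct)
    case (add_square q t)
    then show ?case
      using that sos_add_square[of "r\<^sup>2 * q" n "r * t"]
      by (simp add: polys_mult distrib_left power_mult_distrib)
  qed (simp add: sos_0)
  with assms(1) show ?thesis
    by (induction rule: sos_induct) (auto simp: sos_0 distrib_right intro: sos_add)
qed

lemma sos_of_nat: "of_nat k \<in> sos \<rat> n"
  using sos_add_square[of "of_nat k'" n 1 for k'] polys_of_nat[of 1 n]
  by (induction k) (simp_all add: sos_0 add.commute)

text \<open>
  A nonnegative rational is a sum of rational squares because
  $a / b = a b \cdot (1 / b)^2$ and the natural number $a b$ is a sum of ones.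
\<close>

lemma sos_const:
  assumes "c \<in> \<rat>" "c \<ge> 0"
  shows "const c \<in> sos \<rat> n"
proof -
  obtain a b :: nat where ab: "b \<noteq> 0" "c = real a / real b"
    using Rats_abs_nat_div_natE[OF assms(1)] assms(2) by (metis abs_of_nonneg)
  have "const c = of_nat (a * b) * (const (1 / real b))\<^sup>2"
    unfolding const_simps(3)[symmetric] const_power[symmetric] const_mult[symmetric]
    using ab by (simp add: power2_eq_square)
  then show ?thesis
    by (metis sos_mult sos_of_nat sos_square polys_const Rats_divide Rats_1 Rats_of_nat)
qed

section \<open>Absorbing the constraints by penalty terms\<close>

text \<open>
  The function $u (1-u)^{2k}$ is at most $u$ for negative $u$, while on $[0,1]$ it is uniformly small:
  by Bernoulli's inequality $(1-u)^{2k} (1 + 2 k u) \le (1-u^2)^{2k} \le 1$.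
\<close>

lemma penalty_bound:
  fixes u :: real
  assumes "u \<le> 1" "k > 0"
  shows "u * (1 - u) ^ (2 * k) \<le> min u 0 + 1 / real k"
proof (cases "u < 0")
  case True
  then have "1 \<le> (1 - u) ^ (2 * k)"
    by (intro one_le_power) simp
  then have "u * (1 - u) ^ (2 * k) \<le> u * 1"
    using True by (intro mult_left_mono_neg) auto
  then show ?thesis
    using True by (simp add: min_def add_increasing2)
next
  case False
  then have u: "0 \<le> u" "u \<le> 1"
    using assms by auto
  have "real k * u * (1 - u) ^ (2 * k) \<le> (1 + real (2 * k) * u) * (1 - u) ^ (2 * k)"
    using u by (intro mult_right_mono) (auto simp: mult_right_mono)
  also have "\<dots> \<le> (1 + u) ^ (2 * k) * (1 - u) ^ (2 * k)"
    using u Bernoulli_inequality[of u "2 * k"] by (intro mult_right_mono) auto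
  also have "\<dots> = (1 - u\<^sup>2) ^ (2 * k)"
    by (simp add: power_mult_distrib[symmetric] power2_eq_square algebra_simps)
  also have "\<dots> \<le> 1"
    using u by (intro power_le_one) (auto simp: power_le_one)
  finally show ?thesis
    using u assms(2) by (simp add: field_simps)
qed

text \<open>
  The penalty functions $\max(0, -g_i)$ repair the sign of $f$ where a constraint fails: by
  compactness $f + C \sum_i \max(0, -g_i)$ is positive, hence bounded below by some $\varepsilon > 0$,
  on all of \<open>B\<close> once $C$ is large.  By the previous bound, applied to $u = g_i / R$ with $R$ an upper
  bound of all $g_i$ on \<open>B\<close>, the function $- g_i (1 - g_i / R)^{2k}$ falls below $\max(0, -g_i)$ by at
  most $R / k$, so a large $k$ keeps the sum positive.  The point of this choice is that it has the
  form of a square times $g_i$.  Since $C$, $R$, $k$ are natural numbers, rationality of coefficients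
  is not lost.
\<close>

lemma positive_after_penalty:
  fixes f :: "'a::topological_space \<Rightarrow> real" and g :: "'i \<Rightarrow> 'a \<Rightarrow> real"
  assumes B: "compact B" and I: "finite I"
    and f: "continuous_on B f" and g: "\<And>i. i \<in> I \<Longrightarrow> continuous_on B (g i)"
    and pos: "\<And>x. x \<in> B \<Longrightarrow> (\<And>i. i \<in> I \<Longrightarrow> g i x \<ge> 0) \<Longrightarrow> f x > 0"
  obtains C R k :: nat where "R > 0"
    "\<And>x. x \<in> B \<Longrightarrow> f x - real C * (\<Sum>i\<in>I. g i x * (1 - g i x / real R) ^ (2 * k)) > 0"
proof (cases "B = {}")
  case True
  then show ?thesis
    using that[of 1 0 0] by simp
next
  case False
  define G where "G x = (\<Sum>i\<in>I. max 0 (- g i x))" for x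
  have G: "continuous_on B G"
    unfolding G_def by (intro continuous_intros g)
  have G_nonneg: "G x \<ge> 0" for x
    unfolding G_def by (intro sum_nonneg) auto
  have G_pos: "G x > 0" if "x \<in> B" "f x \<le> 0" for x
  proof -
    have "\<exists>i\<in>I. g i x < 0"
    proof (rule ccontr)
      assume "\<not> ?thesis"
      then have "\<And>i. i \<in> I \<Longrightarrow> g i x \<ge> 0"
        by force
      with pos[of x] that show False
        by force
    qed
    then obtain i where "i \<in> I" "g i x < 0"
      by blast
    then show ?thesis
      unfolding G_def by (intro sum_pos2[OF I]) auto
  qed
  have "\<exists>C::nat. \<forall>x\<in>B. f x + real C * G x > 0"
  proof -
    \<comment> \<open>Only the compact set \<open>?Z\<close>, where the total violation \<open>G\<close> is bounded away from 0, needs a repair.\<close>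
    let ?Z = "{x \<in> B. f x \<le> 0}"
    have "?Z = B \<inter> f -` {..0}"
      by auto
    then have Z: "compact ?Z"
      using closedin_compact[OF B continuous_closedin_preimage[OF f closed_atMost]] by metis
    show ?thesis
    proof (cases "?Z = {}")
      case True
      then show ?thesis
        by (intro exI[of _ 0]) (auto simp: not_le)
    next
      case False
      obtain z where z: "z \<in> ?Z" "\<And>x. x \<in> ?Z \<Longrightarrow> G z \<le> G x"
        using continuous_attains_inf[OF Z False continuous_on_subset[OF G]] by blast
      obtain y where y: "y \<in> B" "\<And>x. x \<in> B \<Longrightarrow> f y \<le> f x"
        using continuous_attains_inf[OF B \<open>B \<noteq> {}\<close> f] by blast
      have "G z > 0"
        using z(1) G_pos by blast
      obtain C :: nat where "- f y / G z < real C"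
        using reals_Archimedean2 by blast
      then have C: "f y + real C * G z > 0"
        using \<open>G z > 0\<close> by (simp add: field_simps)
      have "f x + real C * G x > 0" if "x \<in> B" for x
      proof (cases "f x \<le> 0")
        case True
        then have "real C * G z \<le> real C * G x"
          using z(2) that by (intro mult_left_mono) auto
        then show ?thesis
          using C y(2)[OF that] by linarith
      next
        case False
        then show ?thesis
          by (intro add_pos_nonneg) (auto simp: G_nonneg)
      qed
      then show ?thesis
        by blast
    qed
  qed
  then obtain C :: nat where C: "\<And>x. x \<in> B \<Longrightarrow> f x + real C * G x > 0"
    by blast
  obtain w where w: "w \<in> B" "\<And>x. x \<in> B \<Longrightarrow> f w + real C * G w \<le> f x + real C * G x"
    using continuous_attains_inf[OF B False, of "\<lambda>x. f x + real C * G x"]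
      continuous_on_add[OF f continuous_on_mult_left[OF G]] by blast
  have "\<forall>i\<in>I. \<exists>r. \<forall>x\<in>B. g i x \<le> r"
    using continuous_attains_sup[OF B False g] by metis
  then obtain r where r: "\<And>i x. i \<in> I \<Longrightarrow> x \<in> B \<Longrightarrow> g i x \<le> r i"
    by metis
  obtain R :: nat where R_gt: "1 + (\<Sum>i\<in>I. \<bar>r i\<bar>) < real R"
    using reals_Archimedean2 by blast
  moreover have "(\<Sum>i\<in>I. \<bar>r i\<bar>) \<ge> 0"
    by (simp add: sum_nonneg)
  ultimately have "real R > 0"
    by linarith
  then have "R > 0"
    by simp
  have R: "g i x \<le> real R" if "i \<in> I" "x \<in> B" for i x
  proof -
    have "\<bar>r i\<bar> \<le> (\<Sum>i\<in>I. \<bar>r i\<bar>)"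
      using member_le_sum[OF that(1), of "\<lambda>i. \<bar>r i\<bar>"] I by simp
    then show ?thesis
      using r[OF that] R_gt by linarith
  qed
  define \<epsilon> where "\<epsilon> = f w + real C * G w"
  have "\<epsilon> > 0"
    unfolding \<epsilon>_def using C w by blast
  obtain k :: nat where k': "real C * (real (card I) * real R) / \<epsilon> < real k"
    using reals_Archimedean2 by blast
  have "k > 0"
    using k' \<open>\<epsilon> > 0\<close> by (rule_tac ccontr) (auto simp: not_less divide_less_0_iff mult_less_0_iff)
  have k: "real C * (real (card I) * (real R / real k)) < \<epsilon>"
    using k' \<open>\<epsilon> > 0\<close> \<open>k > 0\<close> by (simp add: field_simps)
  have "f x - real C * (\<Sum>i\<in>I. g i x * (1 - g i x / real R) ^ (2 * k)) > 0" if "x \<in> B" for x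
  proof -
    have "g i x * (1 - g i x / real R) ^ (2 * k) \<le> real R / real k - max 0 (- g i x)" if "i \<in> I" for i
    proof -
      define u where "u = g i x / real R"
      have "u \<le> 1" and gu: "g i x = real R * u"
        using \<open>R > 0\<close> R[OF that \<open>x \<in> B\<close>] by (auto simp: u_def)
      then have "real R * (u * (1 - u) ^ (2 * k)) \<le> real R * (min u 0 + 1 / real k)"
        using penalty_bound \<open>k > 0\<close> by (intro mult_left_mono) auto
      also have "\<dots> = real R / real k - max 0 (- g i x)"
        using \<open>R > 0\<close> by (auto simp: gu min_def max_def field_simps mult_le_0_iff zero_le_mult_iff)
      finally show ?thesis
        using \<open>R > 0\<close> by (simp add: gu mult.assoc)
    qed
    then have "(\<Sum>i\<in>I. g i x * (1 - g i x / real R) ^ (2 * k))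
        \<le> (\<Sum>i\<in>I. real R / real k - max 0 (- g i x))"
      by (intro sum_mono)
    also have "\<dots> = real (card I) * (real R / real k) - G x"
      by (simp add: sum_subtractf G_def)
    finally have "real C * (\<Sum>i\<in>I. g i x * (1 - g i x / real R) ^ (2 * k))
        \<le> real C * (real (card I) * (real R / real k) - G x)"
      by (rule mult_left_mono) simp
    then show ?thesis
      using k w(2)[OF that] by (simp add: \<epsilon>_def right_diff_distrib)
  qed
  then show ?thesis
    using that \<open>R > 0\<close> by blast
qed

section \<open>Bernstein coefficients\<close>

text \<open>
  Subtraction is truncated on the right-hand side, which makes the identity hold also for
  \<open>b \<le> j\<close>, where the left-hand side vanishes.
\<close>

lemma binomial_ratio_Suc:
  assumes "j < d"
  shows "real (b choose Suc j) / real (d choose Suc j) =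
    real (b choose j) / real (d choose j) * (real (b - j) / real (d - j))"
proof -
  have *: "real (Suc j) * real (m choose Suc j) = real (m - j) * real (m choose j)" for m
    by (metis binomial_absorb_comp binomial_absorption mult.commute of_nat_mult)
  have "real (b choose Suc j) / real (d choose Suc j) =
      (real (Suc j) * real (b choose Suc j)) / (real (Suc j) * real (d choose Suc j))"
    by simp
  also have "\<dots> = real (b choose j) / real (d choose j) * (real (b - j) / real (d - j))"
    unfolding * by (simp add: mult.commute)
  finally show ?thesis .
qed

lemma abs_mult_diff_le:
  fixes x y s t :: real
  assumes "0 \<le> y" "y \<le> 1" "0 \<le> s" "s \<le> 1"
  shows "\<bar>x * y - s * t\<bar> \<le> \<bar>x - s\<bar> + \<bar>y - t\<bar>"
proof -
  have "\<bar>x * y - s * t\<bar> = \<bar>(x - s) * y + s * (y - t)\<bar>"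
    by (simp add: algebra_simps)
  also have "\<dots> \<le> \<bar>x - s\<bar> * y + s * \<bar>y - t\<bar>"
    using abs_triangle_ineq[of "(x - s) * y" "s * (y - t)"] assms by (simp add: abs_mult)
  also have "\<dots> \<le> \<bar>x - s\<bar> + \<bar>y - t\<bar>"
    using assms by (intro add_mono mult_left_le mult_left_le_one_le) auto
  finally show ?thesis .
qed

text \<open>
  The ratio is the product over $k < j$ of the factors $(b - k) / (d - k)$, where the subtraction is
  truncated at 0.  Each factor lies in $[0,1]$ and differs from $b / d$ by at most $k / d$.  These ratios
  are the Bernstein coefficients of the $j$-th power function, and the powers of $b / d$ are its values
  at the grid points.
\<close>

lemma binomial_ratio_approx:
  assumes "j \<le> d" "b \<le> d"
  shows "\<bar>real (b choose j) / real (d choose j) - (real b / real d) ^ j\<bar> \<le> (real j)\<^sup>2 / real d"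
  using assms(1)
proof (induction j)
  case (Suc j)
  let ?x = "real (b choose j) / real (d choose j)" and ?y = "real (b - j) / real (d - j)"
  let ?t = "real b / real d"
  have t: "0 \<le> ?t" "?t \<le> 1"
    using assms(2) by (auto simp: divide_le_eq_1)
  have y: "0 \<le> ?y" "?y \<le> 1"
    using assms(2) Suc.prems by (auto simp: divide_le_eq_1)
  have "\<bar>?y - ?t\<bar> \<le> real j / real d"
  proof (cases "b \<le> j")
    case True
    then show ?thesis
      using Suc.prems by (simp add: divide_right_mono)
  next
    case False
    then have j: "j < b" "j < d"
      using Suc.prems by auto
    define v where "v = (real d - real b) / (real d - real j)"
    have "?t - ?y = real j / real d * v"
      using j by (simp add: v_def field_simps of_nat_diff)
    moreover have "0 \<le> v" "v \<le> 1"
      using j assms(2) by (auto simp: v_def divide_le_eq_1)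
    ultimately have "0 \<le> ?t - ?y" "?t - ?y \<le> real j / real d"
      using mult_left_le[of v "real j / real d"] by auto
    then show ?thesis
      by (simp add: abs_minus_commute)
  qed
  moreover have "\<bar>?x - ?t ^ j\<bar> \<le> (real j)\<^sup>2 / real d"
    using Suc by simp
  moreover have "\<bar>?x * ?y - ?t ^ j * ?t\<bar> \<le> \<bar>?x - ?t ^ j\<bar> + \<bar>?y - ?t\<bar>"
    using y t by (intro abs_mult_diff_le power_le_one) auto
  moreover have "(real j)\<^sup>2 / real d + real j / real d \<le> (real (Suc j))\<^sup>2 / real d"
    unfolding add_divide_distrib[symmetric]
    by (intro divide_right_mono) (auto simp: power2_eq_square algebra_simps)
  ultimately have "\<bar>?x * ?y - ?t ^ j * ?t\<bar> \<le> (real (Suc j))\<^sup>2 / real d"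
    by linarith
  then show ?case
    using Suc.prems by (simp add: binomial_ratio_Suc mult.commute)
qed simp

lemma binomial_ratio_unit:
  assumes "b \<le> d"
  shows "real (b choose j) / real (d choose j) \<le> 1"
  using binomial_right_mono[OF assms, of j] by (cases "d < j") (auto simp: not_less binomial_eq_0)

text \<open>
  The affine coordinate that maps $[-M, M]$ onto $[0, 1]$.  It and its complement to 1 are positive
  multiples of $M + X_i$ and $M - X_i$.
\<close>

definition unit_coord :: "real \<Rightarrow> nat \<Rightarrow> rpoly" where
  "unit_coord M i = const (1 / (2 * M)) * (const M + X i)"

definition bernstein :: "real \<Rightarrow> nat \<Rightarrow> nat \<Rightarrow> nat \<Rightarrow> rpoly" where
  "bernstein M d i b = of_nat (d choose b) * unit_coord M i ^ b * (1 - unit_coord M i) ^ (d - b)"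

text \<open>
  Multiply $u^j$ by $1 = (u + (1 - u))^{d - j}$ and expand; the coefficients match because
  $\binom{d}{b} \binom{b}{j} = \binom{d}{j} \binom{d-j}{b-j}$.
\<close>

lemma unit_coord_power_bernstein:
  assumes "j \<le> d"
  shows "unit_coord M i ^ j =
    (\<Sum>b\<le>d. const (real (b choose j) / real (d choose j)) * bernstein M d i b)"
proof -
  let ?u = "unit_coord M i"
  have "?u ^ j = ?u ^ j * (?u + (1 - ?u)) ^ (d - j)"
    by simp
  also have "\<dots> = (\<Sum>c\<le>d - j. of_nat ((d - j) choose c) * ?u ^ (c + j) * (1 - ?u) ^ (d - j - c))"
    unfolding binomial_ring by (simp add: sum_distrib_left power_add mult_ac)
  also have "\<dots> = (\<Sum>b\<in>{j..d}. of_nat ((d - j) choose (b - j)) * ?u ^ b * (1 - ?u) ^ (d - b))"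
    using assms by (intro sum.reindex_bij_witness[of _ "\<lambda>b. b - j" "\<lambda>c. c + j"])
      (auto simp: add.commute)
  also have "\<dots> = (\<Sum>b\<in>{j..d}. const (real (b choose j) / real (d choose j)) * bernstein M d i b)"
  proof (intro sum.cong refl)
    fix b assume b: "b \<in> {j..d}"
    then have "(d choose b) * (b choose j) = (d choose j) * ((d - j) choose (b - j))"
      by (intro choose_mult) auto
    then have "real (d choose b) * real (b choose j) = real (d choose j) * real ((d - j) choose (b - j))"
      by (metis of_nat_mult)
    then have "real (b choose j) / real (d choose j) * real (d choose b) = real ((d - j) choose (b - j))"
      using assms by (simp add: field_simps)
    then have "const (real (b choose j) / real (d choose j)) * of_nat (d choose b) =
        of_nat ((d - j) choose (b - j))"
      by (metis const_mult const_simps(3))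
    then show "of_nat ((d - j) choose (b - j)) * ?u ^ b * (1 - ?u) ^ (d - b) =
        const (real (b choose j) / real (d choose j)) * bernstein M d i b"
      by (simp add: bernstein_def mult.assoc[symmetric])
  qed
  also have "\<dots> = (\<Sum>b\<le>d. const (real (b choose j) / real (d choose j)) * bernstein M d i b)"
    by (intro sum.mono_neutral_left) (auto simp: not_le binomial_eq_0)
  finally show ?thesis .
qed

text \<open>
  The point of the box whose unit coordinates are $\beta_i / d$.
\<close>

definition grid_point :: "nat \<Rightarrow> real \<Rightarrow> nat \<Rightarrow> (nat \<Rightarrow> nat) \<Rightarrow> nat \<Rightarrow> real" where
  "grid_point n M d \<beta> = (\<lambda>i\<in>{1..n}. M * (2 * (real (\<beta> i) / real d) - 1))"

definition bernstein_sum :: "nat \<Rightarrow> real \<Rightarrow> nat \<Rightarrow> ((nat \<Rightarrow> nat) \<Rightarrow> real) \<Rightarrow> rpoly" where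
  "bernstein_sum n M d b =
    (\<Sum>\<beta>\<in>{1..n} \<rightarrow>\<^sub>E {..d}. const (b \<beta>) * (\<Prod>i\<in>{1..n}. bernstein M d i (\<beta> i)))"

definition bernstein_close :: "nat \<Rightarrow> real \<Rightarrow> nat \<Rightarrow> real \<Rightarrow> rpoly \<Rightarrow> bool" where
  "bernstein_close n M d \<epsilon> p \<longleftrightarrow> (\<exists>b. range b \<subseteq> \<rat> \<and> p = bernstein_sum n M d b \<and>
     (\<forall>\<beta>\<in>{1..n} \<rightarrow>\<^sub>E {..d}. \<bar>b \<beta> - peval (grid_point n M d \<beta>) p\<bar> \<le> \<epsilon>))"

text \<open>
  The error rate $K / d$ is part of the notion only because it makes stability under sums and scaling
  immediate; what matters is that the error tends to 0.
\<close>

definition bernstein_approximable :: "nat \<Rightarrow> real \<Rightarrow> rpoly \<Rightarrow> bool" where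
  "bernstein_approximable n M p \<longleftrightarrow> (\<exists>K D. \<forall>d>D. bernstein_close n M d (K / real d) p)"

text \<open>
  For a product of powers of unit coordinates, the Bernstein coefficients are the products of the
  one-variable ones, and a product of factors in $[-1,1]$ varies by at most the sum of the variations
  of the factors.
\<close>

lemma bernstein_approximable_unit_monomial:
  assumes "M > 0"
  shows "bernstein_approximable n M (\<Prod>i\<in>{1..n}. unit_coord M i ^ \<alpha> i)"
  unfolding bernstein_approximable_def
proof (intro exI allI impI)
  fix d assume d: "d > (\<Sum>i\<in>{1..n}. \<alpha> i)"
  have \<alpha>: "\<alpha> i \<le> d" if "i \<in> {1..n}" for i
    using d member_le_sum[OF that, of \<alpha>] by simp
  let ?r = "\<lambda>j b. real (b choose j) / real (d choose j)"
  let ?b = "\<lambda>\<beta>. \<Prod>i\<in>{1..n}. ?r (\<alpha> i) (\<beta> i)"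
  let ?p = "\<Prod>i\<in>{1..n}. unit_coord M i ^ \<alpha> i"
  have "?p = (\<Prod>i\<in>{1..n}. \<Sum>b\<le>d. const (?r (\<alpha> i) b) * bernstein M d i b)"
    using \<alpha> by (intro prod.cong refl unit_coord_power_bernstein)
  also have "\<dots> = bernstein_sum n M d ?b"
    unfolding bernstein_sum_def const_prod prod.distrib[symmetric] by (intro prod_sum_PiE) auto
  finally have repr: "?p = bernstein_sum n M d ?b" .
  have "\<bar>?b \<beta> - peval (grid_point n M d \<beta>) ?p\<bar> \<le> (\<Sum>i\<in>{1..n}. (real (\<alpha> i))\<^sup>2) / real d"
    if \<beta>: "\<beta> \<in> {1..n} \<rightarrow>\<^sub>E {..d}" for \<beta>
  proof -
    have \<beta>_le: "\<beta> i \<le> d" if "i \<in> {1..n}" for i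
      using PiE_mem[OF \<beta> that] by simp
    have "peval (grid_point n M d \<beta>) ?p = (\<Prod>i\<in>{1..n}. (real (\<beta> i) / real d) ^ \<alpha> i)"
      using assms d unfolding peval_prod
      by (intro prod.cong) (auto simp: unit_coord_def grid_point_def field_simps)
    moreover have "\<bar>?b \<beta> - (\<Prod>i\<in>{1..n}. (real (\<beta> i) / real d) ^ \<alpha> i)\<bar>
        \<le> (\<Sum>i\<in>{1..n}. \<bar>?r (\<alpha> i) (\<beta> i) - (real (\<beta> i) / real d) ^ \<alpha> i\<bar>)"
      unfolding real_norm_def[symmetric]
    proof (rule norm_prod_diff)
      fix i assume "i \<in> {1..n}"
      then have "\<beta> i \<le> d"
        by (rule \<beta>_le)
      then show "norm (?r (\<alpha> i) (\<beta> i)) \<le> 1" "norm ((real (\<beta> i) / real d) ^ \<alpha> i) \<le> 1"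
        using d binomial_ratio_unit by (auto intro!: power_le_one simp: divide_le_eq_1)
    qed
    moreover have "(\<Sum>i\<in>{1..n}. \<bar>?r (\<alpha> i) (\<beta> i) - (real (\<beta> i) / real d) ^ \<alpha> i\<bar>)
        \<le> (\<Sum>i\<in>{1..n}. (real (\<alpha> i))\<^sup>2 / real d)"
      using \<alpha> \<beta>_le by (intro sum_mono binomial_ratio_approx)
    ultimately show ?thesis
      by (simp add: sum_divide_distrib)
  qed
  moreover have "range ?b \<subseteq> \<rat>"
    by (auto intro!: Rats_prod Rats_divide)
  ultimately show "bernstein_close n M d ((\<Sum>i\<in>{1..n}. (real (\<alpha> i))\<^sup>2) / real d) ?p"
    unfolding bernstein_close_def using repr by blast
qed

lemma bernstein_close_scale:
  assumes "bernstein_close n M d \<epsilon> p" "c \<in> \<rat>"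
  shows "bernstein_close n M d (\<bar>c\<bar> * \<epsilon>) (const c * p)"
proof -
  obtain b where b: "range b \<subseteq> \<rat>" "p = bernstein_sum n M d b"
    "\<And>\<beta>. \<beta> \<in> {1..n} \<rightarrow>\<^sub>E {..d} \<Longrightarrow> \<bar>b \<beta> - peval (grid_point n M d \<beta>) p\<bar> \<le> \<epsilon>"
    using assms(1) unfolding bernstein_close_def by blast
  have "const c * p = bernstein_sum n M d (\<lambda>\<beta>. c * b \<beta>)"
    unfolding b(2) bernstein_sum_def by (simp add: sum_distrib_left const_mult mult.assoc)
  moreover have "\<bar>c * b \<beta> - peval (grid_point n M d \<beta>) (const c * p)\<bar> \<le> \<bar>c\<bar> * \<epsilon>"
    if "\<beta> \<in> {1..n} \<rightarrow>\<^sub>E {..d}" for \<beta>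
  proof -
    have "c * b \<beta> - peval (grid_point n M d \<beta>) (const c * p) =
        c * (b \<beta> - peval (grid_point n M d \<beta>) p)"
      unfolding peval_mult peval_const by (simp only: right_diff_distrib)
    then show ?thesis
      using mult_left_mono[OF b(3)[OF that], of "\<bar>c\<bar>"] by (simp only: abs_mult abs_ge_zero)
  qed
  moreover have "range (\<lambda>\<beta>. c * b \<beta>) \<subseteq> \<rat>"
    using b(1) assms(2) by auto
  ultimately show ?thesis
    unfolding bernstein_close_def by blast
qed

lemma bernstein_close_add:
  assumes "bernstein_close n M d \<epsilon> p" "bernstein_close n M d \<delta> q"
  shows "bernstein_close n M d (\<epsilon> + \<delta>) (p + q)"
proof -
  obtain b where b: "range b \<subseteq> \<rat>" "p = bernstein_sum n M d b"
    "\<And>\<beta>. \<beta> \<in> {1..n} \<rightarrow>\<^sub>E {..d} \<Longrightarrow> \<bar>b \<beta> - peval (grid_point n M d \<beta>) p\<bar> \<le> \<epsilon>"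
    using assms(1) unfolding bernstein_close_def by blast
  obtain c where c: "range c \<subseteq> \<rat>" "q = bernstein_sum n M d c"
    "\<And>\<beta>. \<beta> \<in> {1..n} \<rightarrow>\<^sub>E {..d} \<Longrightarrow> \<bar>c \<beta> - peval (grid_point n M d \<beta>) q\<bar> \<le> \<delta>"
    using assms(2) unfolding bernstein_close_def by blast
  have "p + q = bernstein_sum n M d (\<lambda>\<beta>. b \<beta> + c \<beta>)"
    unfolding b(2) c(2) bernstein_sum_def by (simp add: const_add distrib_right sum.distrib)
  moreover have "\<bar>b \<beta> + c \<beta> - peval (grid_point n M d \<beta>) (p + q)\<bar> \<le> \<epsilon> + \<delta>"
    if "\<beta> \<in> {1..n} \<rightarrow>\<^sub>E {..d}" for \<beta>
    using b(3)[OF that] c(3)[OF that] by simp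
  moreover have "range (\<lambda>\<beta>. b \<beta> + c \<beta>) \<subseteq> \<rat>"
    using b(1) c(1) by (auto simp: image_subset_iff)
  ultimately show ?thesis
    unfolding bernstein_close_def by blast
qed

lemma bernstein_approximable_scale:
  assumes "bernstein_approximable n M p" "c \<in> \<rat>"
  shows "bernstein_approximable n M (const c * p)"
proof -
  obtain K D where "\<forall>d>D. bernstein_close n M d (K / real d) p"
    using assms(1) unfolding bernstein_approximable_def by blast
  then have "\<forall>d>D. bernstein_close n M d (\<bar>c\<bar> * K / real d) (const c * p)"
    using bernstein_close_scale[OF _ assms(2)] by fastforce
  then show ?thesis
    unfolding bernstein_approximable_def by blast
qed

lemma bernstein_approximable_0: "bernstein_approximable n M 0"
  unfolding bernstein_approximable_def bernstein_close_def bernstein_sum_def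
  by (intro exI[of _ 0] allI impI exI[of _ "\<lambda>_. 0"]) auto

lemma bernstein_approximable_add:
  assumes "bernstein_approximable n M p" "bernstein_approximable n M q"
  shows "bernstein_approximable n M (p + q)"
proof -
  obtain K D where p: "\<forall>d>D. bernstein_close n M d (K / real d) p"
    using assms(1) unfolding bernstein_approximable_def by blast
  obtain K' D' where q: "\<forall>d>D'. bernstein_close n M d (K' / real d) q"
    using assms(2) unfolding bernstein_approximable_def by blast
  have "\<forall>d>max D D'. bernstein_close n M d ((K + K') / real d) (p + q)"
    using p q by (auto simp: add_divide_distrib intro: bernstein_close_add)
  then show ?thesis
    unfolding bernstein_approximable_def by blast
qed

lemma bernstein_approximable_sum:
  "(\<And>a. a \<in> A \<Longrightarrow> bernstein_approximable n M (p a)) \<Longrightarrow> bernstein_approximable n M (sum p A)"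
  by (induction A rule: infinite_finite_induct)
    (auto intro: bernstein_approximable_0 bernstein_approximable_add)

lemma X_power_unit_coord:
  assumes "M > 0"
  shows "X i ^ a = (\<Sum>j\<le>a. const (real (a choose j) * (2 * M) ^ j * (- M) ^ (a - j)) * unit_coord M i ^ j)"
proof -
  have "const (2 * M) * unit_coord M i = const M + X i"
    using assms by (simp add: unit_coord_def mult.assoc[symmetric] flip: const_mult)
  then have "X i = const (2 * M) * unit_coord M i + const (- M)"
    using const_diff[of 0 M] by simp
  then have "X i ^ a = (const (2 * M) * unit_coord M i + const (- M)) ^ a"
    by simp
  then show ?thesis
    unfolding binomial_ring by (simp add: const_mult const_power power_mult_distrib mult_ac)
qed

text \<open>
  The binomial theorem rewrites the monomials in the $X_i$ as rational combinations of monomials in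
  the unit coordinates.
\<close>

lemma bernstein_approximable_rational_poly:
  assumes p: "p \<in> polys \<rat> n" and M: "M \<in> \<rat>" "M > 0"
  shows "bernstein_approximable n M p"
proof -
  have "bernstein_approximable n M (\<Prod>i\<in>{1..n}. X i ^ \<mu> i)" for \<mu>
  proof -
    let ?c = "\<lambda>i j. real (\<mu> i choose j) * (2 * M) ^ j * (- M) ^ (\<mu> i - j)"
    have "(\<Prod>i\<in>{1..n}. X i ^ \<mu> i) =
        (\<Prod>i\<in>{1..n}. \<Sum>j\<le>\<mu> i. const (?c i j) * unit_coord M i ^ j)"
      by (intro prod.cong refl X_power_unit_coord M)
    also have "\<dots> = (\<Sum>\<alpha>\<in>PiE {1..n} (\<lambda>i. {..\<mu> i}).
        const (\<Prod>i\<in>{1..n}. ?c i (\<alpha> i)) * (\<Prod>i\<in>{1..n}. unit_coord M i ^ \<alpha> i))"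
      unfolding const_prod prod.distrib[symmetric] by (intro prod_sum_PiE) auto
    also have "bernstein_approximable n M \<dots>"
      using M by (intro bernstein_approximable_sum bernstein_approximable_scale
          bernstein_approximable_unit_monomial Rats_prod) auto
    finally show ?thesis .
  qed
  then show ?thesis
    using p by (subst sum_const_times_monomials[OF p])
      (auto intro!: bernstein_approximable_sum bernstein_approximable_scale simp: polys_def)
qed

text \<open>
  A polynomial that is positive on the box is bounded below there by a positive number, so in high
  degree its Bernstein coefficients are positive.  Its Bernstein expansion then writes it with sums and
  products of nonnegative rationals and the polynomials $M \pm X_i$ that define the faces of the box.
\<close>

lemma positive_on_box:
  assumes h: "h \<in> polys \<rat> n" and M: "M \<in> \<rat>" "M > 0"
    and pos: "\<And>x. x \<in> {1..n} \<rightarrow>\<^sub>E {-M..M} \<Longrightarrow> peval x h > 0"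
    and const: "\<And>c. c \<in> \<rat> \<Longrightarrow> c \<ge> 0 \<Longrightarrow> const c \<in> T"
    and add: "\<And>p q. p \<in> T \<Longrightarrow> q \<in> T \<Longrightarrow> p + q \<in> T"
    and mult: "\<And>p q. p \<in> T \<Longrightarrow> q \<in> T \<Longrightarrow> p * q \<in> T"
    and faces: "\<And>i. i \<in> {1..n} \<Longrightarrow> const M + X i \<in> T" "\<And>i. i \<in> {1..n} \<Longrightarrow> const M - X i \<in> T"
  shows "h \<in> T"
proof -
  let ?B = "{1..n} \<rightarrow>\<^sub>E {-M..M}"
  have "?B \<noteq> {}"
    using M(2) by (simp add: PiE_eq_empty_iff)
  then obtain w where w: "w \<in> ?B" "\<And>x. x \<in> ?B \<Longrightarrow> peval w h \<le> peval x h"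
    using continuous_attains_inf[where f = "\<lambda>x. peval x h", OF compact_box _ continuous_on_peval]
    by meson
  obtain K D where KD: "\<And>d. d > D \<Longrightarrow> bernstein_close n M d (K / real d) h"
    using bernstein_approximable_rational_poly[OF h M] unfolding bernstein_approximable_def by blast
  obtain d0 :: nat where "K / peval w h < real d0"
    using reals_Archimedean2 by blast
  define d where "d = Suc (d0 + D)"
  have d: "d > D" "d > 0" "K / real d < peval w h"
  proof -
    have "K / peval w h < real d"
      using \<open>K / peval w h < real d0\<close> by (simp add: d_def)
    then show "K / real d < peval w h"
      using pos[OF w(1)] by (simp add: field_simps d_def)
  qed (auto simp: d_def)
  obtain b where b: "range b \<subseteq> \<rat>" "h = bernstein_sum n M d b"
    "\<And>\<beta>. \<beta> \<in> {1..n} \<rightarrow>\<^sub>E {..d} \<Longrightarrow> \<bar>b \<beta> - peval (grid_point n M d \<beta>) h\<bar> \<le> K / real d"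
    using KD[OF d(1)] unfolding bernstein_close_def by blast
  have b_nonneg: "b \<beta> \<ge> 0" if \<beta>: "\<beta> \<in> {1..n} \<rightarrow>\<^sub>E {..d}" for \<beta>
  proof -
    have "M * (2 * (real (\<beta> i) / real d) - 1) \<in> {-M..M}" if "i \<in> {1..n}" for i
    proof -
      define t where "t = real (\<beta> i) / real d"
      have "\<beta> i \<le> d"
        using PiE_mem[OF \<beta> that] by simp
      then have "0 \<le> t" "t \<le> 1"
        using d(2) by (auto simp: t_def)
      then have "M * t \<le> M" "0 \<le> M * t"
        using M(2) by (auto simp: mult_left_le)
      then show ?thesis
        by (simp add: right_diff_distrib flip: t_def)
    qed
    then have "grid_point n M d \<beta> \<in> ?B"
      by (auto simp: grid_point_def)
    then show ?thesis
      using w(2)[of "grid_point n M d \<beta>"] b(3)[OF \<beta>] d(3) by linarith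
  qed
  have T_sum: "(\<And>a. a \<in> A \<Longrightarrow> p a \<in> T) \<Longrightarrow> sum p A \<in> T" for p :: "(nat \<Rightarrow> nat) \<Rightarrow> rpoly" and A
    using const[of 0] by (induction A rule: infinite_finite_induct) (auto intro: add)
  have T_prod: "(\<And>a. a \<in> A \<Longrightarrow> p a \<in> T) \<Longrightarrow> prod p A \<in> T" for p :: "nat \<Rightarrow> rpoly" and A
    using const[of 1] by (induction A rule: infinite_finite_induct) (auto intro: mult)
  have T_power: "p \<in> T \<Longrightarrow> p ^ k \<in> T" for p k
    using T_prod[of "{..<k}" "\<lambda>_. p"] by simp
  have T_bernstein: "bernstein M d i c \<in> T" if "i \<in> {1..n}" for i c
  proof -
    have half: "const (1 / (2 * M)) \<in> T"
      using M by (intro const Rats_divide Rats_mult) auto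
    have "1 - unit_coord M i = const (1 / (2 * M)) * (const M - X i)"
    proof -
      have "const (1 / (2 * M)) * (const M + const M) = 1"
        using M(2) by (simp flip: const_add const_mult)
      then show ?thesis
        unfolding unit_coord_def by (simp add: algebra_simps)
    qed
    then have "unit_coord M i \<in> T" "1 - unit_coord M i \<in> T"
      using half faces[OF that] mult unfolding unit_coord_def by auto
    moreover have "of_nat (d choose c) \<in> T"
      using const[of "real (d choose c)"] by simp
    ultimately show ?thesis
      unfolding bernstein_def by (intro mult T_power)
  qed
  show ?thesis
    using b(1) unfolding b(2) bernstein_sum_def
    by (intro T_sum mult const T_prod T_bernstein b_nonneg) auto
qed

section \<open>The preordering generated by one polynomial\<close>

definition preordering :: "nat \<Rightarrow> rpoly \<Rightarrow> rpoly set" where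
  "preordering n G = {a + b * G | a b. a \<in> sos \<rat> n \<and> b \<in> sos \<rat> n}"

lemma preordering_add:
  assumes "p \<in> preordering n G" "q \<in> preordering n G"
  shows "p + q \<in> preordering n G"
proof -
  obtain a b c d where *: "a \<in> sos \<rat> n" "b \<in> sos \<rat> n" "c \<in> sos \<rat> n" "d \<in> sos \<rat> n"
    "p = a + b * G" "q = c + d * G"
    using assms unfolding preordering_def by blast
  then have "p + q = (a + c) + (b + d) * G"
    by (simp add: algebra_simps)
  moreover have "a + c \<in> sos \<rat> n" "b + d \<in> sos \<rat> n"
    using * by (auto intro: sos_add)
  ultimately show ?thesis
    unfolding preordering_def by blast
qed

text \<open>
  With a single generator the quadratic module is closed under products, because the only new
  product of generators, $G \cdot G$, is itself a square.
\<close>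

lemma preordering_mult:
  assumes "G \<in> polys \<rat> n" "p \<in> preordering n G" "q \<in> preordering n G"
  shows "p * q \<in> preordering n G"
proof -
  obtain a b c d where *: "a \<in> sos \<rat> n" "b \<in> sos \<rat> n" "c \<in> sos \<rat> n" "d \<in> sos \<rat> n"
    "p = a + b * G" "q = c + d * G"
    using assms(2,3) unfolding preordering_def by blast
  then have "p * q = (a * c + b * d * G\<^sup>2) + (a * d + b * c) * G"
    by (simp add: algebra_simps power2_eq_square)
  moreover have "a * c + b * d * G\<^sup>2 \<in> sos \<rat> n" "a * d + b * c \<in> sos \<rat> n"
    using * assms(1) by (auto intro!: sos_add sos_mult sos_square)
  ultimately show ?thesis
    unfolding preordering_def by blast
qed

lemma preordering_const:
  assumes "c \<in> \<rat>" "c \<ge> 0"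
  shows "const c \<in> preordering n G"
  using sos_const[OF assms] sos_0 unfolding preordering_def by force

text \<open>
  The ball $\|x\|^2 \le N$ lies in the box $[-M, M]^n$ with $M = N + 1$ because $N \le M^2$.  The
  identity that certifies this for the face $M + e \ge 0$, where $e = \pm X_i$, is
  $$2 M (M + e) = (M + e)^2 + (M^2 - N) + \sum_{j \ne i} X_j^2 + \Bigl(N - \sum_j X_j^2\Bigr).$$
\<close>

lemma box_face_in_ball_preordering:
  fixes N :: nat
  assumes "i \<in> {1..n}" and e: "e = X i \<or> e = - X i"
  defines "G \<equiv> of_nat N - (\<Sum>i = 1..n. (X i)\<^sup>2)"
  shows "const (real (Suc N)) + e \<in> preordering n G"
proof -
  let ?M = "real (Suc N)"
  define h where "h = const (1 / (2 * ?M))"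
  define m where "m = const ?M"
  define rest where "rest = (\<Sum>j\<in>{1..n} - {i}. (X j)\<^sup>2)"
  define slack where "slack = const (?M\<^sup>2 - real N)"
  have G: "G = of_nat N - (X i)\<^sup>2 - rest"
    unfolding G_def rest_def using assms(1) by (simp add: sum.remove algebra_simps)
  have e2: "e\<^sup>2 = (X i)\<^sup>2"
    using e by auto
  have slack: "slack = m\<^sup>2 - of_nat N"
    by (simp add: slack_def m_def const_diff const_power del: of_nat_Suc)
  have hm: "h * m + h * m = 1"
    unfolding h_def m_def by (simp flip: const_mult const_add)
  have hs: "h \<in> sos \<rat> n" "slack \<in> sos \<rat> n"
    unfolding h_def slack_def
    by (intro sos_const; auto simp: power2_eq_square algebra_simps)+
  have "rest \<in> sos \<rat> n"
    unfolding rest_def by (intro sos_sum sos_square polys_X) auto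
  moreover have "m + e \<in> polys \<rat> n"
    using e
  proof
    assume "e = X i"
    then show ?thesis
      unfolding m_def using assms(1) by (simp only:) (intro polys_add polys_const polys_X Rats_of_nat)
  next
    assume "e = - X i"
    then have "m + e = const ?M - X i"
      by (simp add: m_def)
    then show ?thesis
      using assms(1) by (simp only:) (intro polys_diff polys_const polys_X Rats_of_nat)
  qed
  ultimately have "h * ((m + e)\<^sup>2 + slack + rest) \<in> sos \<rat> n"
    using hs by (intro sos_mult sos_add sos_square)
  moreover have "m + e = h * ((m + e)\<^sup>2 + slack + rest) + h * G"
  proof -
    have "h * ((m + e)\<^sup>2 + slack + rest) + h * G = (h * m + h * m) * (m + e)"
      unfolding G slack using e2 by (simp add: power2_eq_square algebra_simps)
    then show ?thesis
      by (simp add: hm)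
  qed
  ultimately show ?thesis
    using hs(1) unfolding m_def preordering_def by blast
qed

section \<open>The rational Positivstellensatz\<close>

theorem theorem6:
  fixes n s N :: nat and g :: "nat \<Rightarrow> rpoly" and f :: rpoly
  assumes "\<forall>i \<in> {1..s}. g i \<in> polys \<rat> n"
    and "of_nat N - (\<Sum>i = 1..n. (X i)\<^sup>2) \<in> quadratic_module n s g"
    and "f \<in> polys \<rat> n"
    and "\<forall>x \<in> semialg_set n s g. peval x f > 0"
  shows "\<exists>\<sigma> \<tau>. (\<forall>i \<in> {0..s}. \<sigma> i \<in> sos \<rat> n) \<and> \<tau> \<in> sos \<rat> n \<and>
    f = \<sigma> 0 + (\<Sum>i = 1..s. \<sigma> i * g i) + \<tau> * (of_nat N - (\<Sum>i = 1..n. (X i)\<^sup>2))"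
proof -
  define M where "M = real (Suc N)"
  have M: "M \<in> \<rat>" "M > 0"
    by (simp_all add: M_def)
  define G where "G = of_nat N - (\<Sum>i = 1..n. (X i)\<^sup>2)"
  \<comment> \<open>The ball constraint becomes the generator with index 0, so that the box, which is larger than the
    ball, can serve as the compact set.\<close>
  define g' where "g' = g(0 := G)"
  have G_poly: "G \<in> polys \<rat> n"
    unfolding G_def by (intro polys_diff polys_sum polys_of_nat polys_power polys_X)
  then have g'_poly: "g' i \<in> polys \<rat> n" if "i \<in> {0..s}" for i
    using assms(1) that by (auto simp: g'_def)
  have f_pos: "peval x f > 0"
    if "x \<in> {1..n} \<rightarrow>\<^sub>E {-M..M}" and "\<And>i. i \<in> {0..s} \<Longrightarrow> peval x (g' i) \<ge> 0" for x
  proof -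
    have "peval x (g i) \<ge> 0" if "i \<in> {1..s}" for i
      using \<open>\<And>i. i \<in> {0..s} \<Longrightarrow> peval x (g' i) \<ge> 0\<close>[of i] that by (simp add: g'_def)
    then show ?thesis
      using that(1) assms(4) by (auto simp: semialg_set_def PiE_def)
  qed
  obtain R C k :: nat where pos:
    "\<And>x. x \<in> {1..n} \<rightarrow>\<^sub>E {-M..M} \<Longrightarrow> peval x f -
      real C * (\<Sum>i\<in>{0..s}. peval x (g' i) * (1 - peval x (g' i) / real R) ^ (2 * k)) > 0"
  proof (rule positive_after_penalty[where f = "\<lambda>x. peval x f" and g = "\<lambda>i x. peval x (g' i)",
        OF compact_box finite_atLeastAtMost continuous_on_peval continuous_on_peval])
    show "peval x f > 0"
      if "x \<in> {1..n} \<rightarrow>\<^sub>E {-M..M}" "\<And>i. i \<in> {0..s} \<Longrightarrow> peval x (g' i) \<ge> 0" for x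
      using that by (rule f_pos)
  qed (rule that)
  define q where "q i = (1 - const (1 / real R) * g' i) ^ k" for i
  define \<rho> where "\<rho> i = of_nat C * (q i)\<^sup>2" for i
  have \<rho>: "\<rho> i \<in> sos \<rat> n" if "i \<in> {0..s}" for i
    unfolding \<rho>_def q_def using that polys_of_nat[of 1 n]
    by (intro sos_mult sos_of_nat sos_square polys_power polys_diff polys_mult polys_const g'_poly) auto
  \<comment> \<open>Evaluating \<open>h\<close> gives the function that \<open>pos\<close> says is positive on the box.\<close>
  define h where "h = f - of_nat C * (\<Sum>i\<in>{0..s}. (q i)\<^sup>2 * g' i)"
  have "h \<in> preordering n G"
  proof (rule positive_on_box[of h n M])
    show "h \<in> polys \<rat> n"
      unfolding h_def q_def using assms(3) polys_of_nat[of 1 n] g'_poly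
      by (intro polys_diff polys_mult polys_sum polys_power polys_const polys_of_nat) auto
    show "peval x h > 0" if "x \<in> {1..n} \<rightarrow>\<^sub>E {-M..M}" for x
      using pos[OF that] by (simp add: h_def q_def power_mult[symmetric] mult_ac)
    show "const M + X i \<in> preordering n G" if "i \<in> {1..n}" for i
      using box_face_in_ball_preordering[OF that, of "X i" N] by (simp add: G_def M_def)
    show "const M - X i \<in> preordering n G" if "i \<in> {1..n}" for i
      using box_face_in_ball_preordering[OF that, of "- X i" N] by (simp add: G_def M_def)
  qed (use M G_poly in \<open>auto intro: preordering_const preordering_add preordering_mult\<close>)
  then obtain a b where ab: "a \<in> sos \<rat> n" "b \<in> sos \<rat> n" "h = a + b * G"
    unfolding preordering_def by blast
  \<comment> \<open>The penalty term of the ball joins the multiplier \<open>b\<close> of \<open>G\<close>.\<close>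
  have "(\<Sum>i\<in>{0..s}. \<rho> i * g' i) = \<rho> 0 * G + (\<Sum>i = 1..s. \<rho> i * g i)"
    by (simp add: sum.atLeast_Suc_atMost g'_def)
  moreover have "f = h + (\<Sum>i\<in>{0..s}. \<rho> i * g' i)"
    by (simp add: h_def \<rho>_def sum_distrib_left mult.assoc)
  ultimately have "f = a + (\<Sum>i = 1..s. \<rho> i * g i) + (b + \<rho> 0) * G"
    using ab(3) by (simp add: algebra_simps)
  then have "f = (\<rho>(0 := a)) 0 + (\<Sum>i = 1..s. (\<rho>(0 := a)) i * g i) + (b + \<rho> 0) * G"
    by simp
  moreover have "\<forall>i\<in>{0..s}. (\<rho>(0 := a)) i \<in> sos \<rat> n" "b + \<rho> 0 \<in> sos \<rat> n"
    using ab \<rho> by (auto intro: sos_add)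
  ultimately show ?thesis
    unfolding G_def by blast
qed

end
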